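(* Let $N\ge 1$, $p>1$, $\lambda>0$ and $\psi(x):=\exp(\lambda x_N^2)$. For $\kappa>0$ let $T(\kappa\psi)$ be the life span of solutions to the problem $$\partial_t u=\Delta u\ \ (x\in\mathbf{R}^N_+,\,t>0),\qquad -\frac{\partial u}{\partial x_N}=u^p\ \ (x\in\partial\mathbf{R}^N_+,\,t>0),\qquad u(x,0)=\kappa\psi(x).$$ Then $$\lim_{\kappa\to+0}T(\kappa\psi)=(4\lambda)^{-1}.$$
   Context: Notation: $\mathbf{R}^N_+:=\{y\in\mathbf{R}^N:y_N>0\}$, $D:=\overline{\mathbf{R}^N_+}$, $y=(y',y_N)$ with $y'=(y_1,\dots,y_{N-1})$. $G=G(x,y,t)$ is the Green function for the heat equation on $\mathbf{R}^N_+$ with homogeneous Neumann boundary condition, i.e. $G(x,y,t)=(4\pi t)^{-N/2}\bigl[e^{-|x-y|^2/(4t)}+e^{-|x-y_*|^2/(4t)}\bigr]$ with $y_*=(y',-y_N)$. Solution: let $\varphi$ be a nonnegative measurable function in $\mathbf{R}^N_+$ and $0<T<\infty$. A nonnegative continuous function $u$ in $D\times(0,T)$ is a solution in $[0,T)$ with $u(0)=\varphi$ if $$u(x,t)=\int_D G(x,y,t)\varphi(y)\,dy+\int_0^t\int_{\mathbf{R}^{N-1}}G(x,y',0,t-s)\,u(y',0,s)^p\,dy'\,ds$$ for all $(x,t)\in D\times(0,T)$ (for $N=1$ the inner integral is just evaluation at the boundary point $0$). It is a minimal solution in $[0,T)$ if moreover $u\le w$ in $D\times(0,T)$ for every solution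 $w$ in $[0,T)$ with $w(0)=\varphi$. Life span: $T(\kappa\psi)$ is the maximal existence time of the minimal solution with $u(0)=\kappa\psi$, i.e. the supremum (possibly $\infty$) of all $T>0$ such that a minimal solution in $[0,T)$ exists, with $T(\kappa\psi)=0$ if there is no such $T$. *)

theory Defs
  imports "HOL-Analysis.Analysis"
begin

text \<open>
  The space \<open>R^N\<close> is \<^typ>\<open>real ^ 'n\<close> with \<open>N = CARD('n)\<close>. A coordinate \<open>k :: 'n\<close> is singled out and plays
  the role of the last coordinate \<open>N\<close>; the other coordinates make up \<open>y'\<close>.
\<close>

definition half_space :: "'n::finite \<Rightarrow> (real ^ 'n) set" where
  "half_space k = {y. y $ k > 0}"

definition reflect :: "'n::finite \<Rightarrow> real ^ 'n \<Rightarrow> real ^ 'n" where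
  "reflect k y = (\<chi> i. if i = k then - (y $ i) else y $ i)"

text \<open>
  A point \<open>y'\<close> of \<open>R^(N-1)\<close> is a function on the index set \<open>- {k}\<close>, with Lebesgue measure
  \<open>\<Pi>\<^sub>M i\<in>- {k}. lborel\<close>, and \<open>bdry_pt k y'\<close> is \<open>(y', 0)\<close>. For \<open>N = 1\<close> the index set is empty and the
  product measure is the unit mass at one point, so that integration is evaluation at the boundary
  point \<open>0\<close>.
\<close>

definition bdry_pt :: "'n::finite \<Rightarrow> ('n \<Rightarrow> real) \<Rightarrow> real ^ 'n" where
  "bdry_pt k z = (\<chi> i. if i = k then 0 else z i)"

definition neumann_green :: "'n::finite \<Rightarrow> real ^ 'n \<Rightarrow> real ^ 'n \<Rightarrow> real \<Rightarrow> real" where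
  "neumann_green k x y t =
     (4 * pi * t) powr (- (real CARD('n) / 2)) *
     (exp (- ((norm (x - y))\<^sup>2 / (4 * t))) + exp (- ((norm (x - reflect k y))\<^sup>2 / (4 * t))))"

text \<open>
  All integrands are nonnegative, so the integrals are taken in \<open>[0,\<infinity>]\<close>; the integral equation forces
  them to be finite. Only the values of \<open>\<phi>\<close> on the open half space matter, its boundary being a null set.
\<close>

definition is_solution ::
  "'n::finite \<Rightarrow> real \<Rightarrow> (real ^ 'n \<Rightarrow> real) \<Rightarrow> real \<Rightarrow> (real ^ 'n \<Rightarrow> real \<Rightarrow> real) \<Rightarrow> bool" where
  "is_solution k p \<phi> T u \<longleftrightarrow>
     \<phi> \<in> borel_measurable (lebesgue_on (half_space k)) \<and>
     (\<forall>y\<in>half_space k. 0 \<le> \<phi> y) \<and>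
     0 < T \<and>
     continuous_on (closure (half_space k) \<times> {0<..<T}) (\<lambda>(x, t). u x t) \<and>
     (\<forall>x\<in>closure (half_space k). \<forall>t\<in>{0<..<T}. 0 \<le> u x t) \<and>
     (\<forall>x\<in>closure (half_space k). \<forall>t\<in>{0<..<T}.
        ennreal (u x t) =
          (\<integral>\<^sup>+y\<in>closure (half_space k). ennreal (neumann_green k x y t * \<phi> y) \<partial>lebesgue) +
          (\<integral>\<^sup>+s\<in>{0<..<t}.
             (\<integral>\<^sup>+z. ennreal (neumann_green k x (bdry_pt k z) (t - s) * u (bdry_pt k z) s powr p)
                \<partial>(\<Pi>\<^sub>M i\<in>- {k}. lborel)) \<partial>lborel))"

definition is_minimal_solution ::
  "'n::finite \<Rightarrow> real \<Rightarrow> (real ^ 'n \<Rightarrow> real) \<Rightarrow> real \<Rightarrow> (real ^ 'n \<Rightarrow> real \<Rightarrow> real) \<Rightarrow> bool" where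
  "is_minimal_solution k p \<phi> T u \<longleftrightarrow>
     is_solution k p \<phi> T u \<and>
     (\<forall>w. is_solution k p \<phi> T w \<longrightarrow>
        (\<forall>x\<in>closure (half_space k). \<forall>t\<in>{0<..<T}. u x t \<le> w x t))"

text \<open>In \<^typ>\<open>ennreal\<close> the supremum of the empty set is \<open>0\<close>.\<close>

definition life_span :: "'n::finite \<Rightarrow> real \<Rightarrow> (real ^ 'n \<Rightarrow> real) \<Rightarrow> ennreal" where
  "life_span k p \<phi> = Sup {ennreal T | T. 0 < T \<and> (\<exists>u. is_minimal_solution k p \<phi> T u)}"

end

theory Submission
  imports Defs "HOL-Probability.Distributions"
begin

text \<open>
  The datum depends only on \<open>x\<^sub>N\<close> and is even, so the heat semigroup with Neumann condition acts on it
  as the one-dimensional Gauss kernel on the whole line and yields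
  \<open>exp (l x\<^sub>N\<^sup>2 / (1 - 4 l t)) / sqrt (1 - 4 l t)\<close>. At \<open>t = 1 / (4 l)\<close> the defining integral diverges,
  so no solution lives longer, whatever \<open>\<kappa>\<close> is. Conversely, for \<open>T < 1 / (4 l)\<close> the equation reduces to
  a scalar Abel-type equation \<open>v = \<kappa> h + K (v\<^sup>p)\<close> for the boundary values, with \<open>h\<close> bounded on
  \<open>(0, T)\<close>. Since \<open>p > 1\<close>, on a small ball \<open>0 \<le> v \<le> M\<close> the map is a contraction once \<open>\<kappa>\<close> is small.
  Its Picard iterates started at \<open>0\<close> stay below every solution of the full problem, so the limit is
  the minimal solution.
\<close>

section \<open>Heat kernels and Gaussian integrals\<close>

definition heat_kernel :: "real \<Rightarrow> real \<Rightarrow> real" where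
  "heat_kernel t r = exp (- (r\<^sup>2 / (4 * t))) / sqrt (4 * pi * t)"

lemma heat_kernel_nonneg [simp]: "0 < t \<Longrightarrow> 0 \<le> heat_kernel t r"
  by (simp add: heat_kernel_def)

lemma heat_kernel_minus [simp]: "heat_kernel t (- r) = heat_kernel t r"
  by (simp add: heat_kernel_def)

lemma borel_measurable_heat_kernel [measurable]: "heat_kernel t \<in> borel_measurable borel"
  unfolding heat_kernel_def by measurable

lemma nn_integral_normal_density:
  assumes "0 < \<sigma>"
  shows "(\<integral>\<^sup>+r. ennreal (normal_density \<mu> \<sigma> r) \<partial>lborel) = 1"
  using assms by (simp add: nn_integral_eq_integral)

text \<open>Completing the square turns the integrand into a multiple of a normal density.\<close>

lemma nn_integral_heat_kernel_exp_square:
  assumes t: "0 < t" and lt: "4 * l * t < 1"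
  shows "(\<integral>\<^sup>+r. ennreal (heat_kernel t (x - r) * exp (l * r\<^sup>2)) \<partial>lborel)
    = ennreal (exp (l * x\<^sup>2 / (1 - 4 * l * t)) / sqrt (1 - 4 * l * t))"
proof -
  define a where "a = 1 - 4 * l * t"
  have a: "0 < a" using lt by (simp add: a_def)
  define C where "C = exp (l * x\<^sup>2 / a) / sqrt a"
  \<comment> \<open>The exponent \<open>- (x - r)^2 / (4 t) + l r^2\<close> equals
    \<open>l x^2 / a - a (r - x / a)^2 / (4 t)\<close>: mean \<open>x / a\<close>, variance
    \<open>2 t / a\<close>. \<open>C\<close> collects the part free of \<open>r\<close>.\<close>
  define \<sigma> where "\<sigma> = sqrt (2 * t / a)"
  have \<sigma>: "0 < \<sigma>" "\<sigma>\<^sup>2 = 2 * t / a" using a t by (auto simp: \<sigma>_def)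
  have eq: "heat_kernel t (x - r) * exp (l * r\<^sup>2) = C * normal_density (x / a) \<sigma> r" for r
  proof -
    have l: "l = (1 - a) / (4 * t)" using t by (simp add: a_def)
    have "- ((x - r)\<^sup>2 / (4 * t)) + l * r\<^sup>2 = l * x\<^sup>2 / a + - (r - x / a)\<^sup>2 / (2 * \<sigma>\<^sup>2)"
      unfolding \<sigma> l using a t
      by (simp add: divide_simps power2_eq_square) (simp add: algebra_simps)
    moreover have "sqrt (2 * pi * \<sigma>\<^sup>2) * sqrt a = sqrt (4 * pi * t)"
      unfolding real_sqrt_mult[symmetric] \<sigma> using a by (simp add: field_simps)
    ultimately show ?thesis
      unfolding heat_kernel_def C_def normal_density_def
      by (simp add: exp_add[symmetric] field_simps)
  qed
  have "(\<integral>\<^sup>+r. ennreal (heat_kernel t (x - r) * exp (l * r\<^sup>2)) \<partial>lborel)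
      = (\<integral>\<^sup>+r. ennreal C * ennreal (normal_density (x / a) \<sigma> r) \<partial>lborel)"
    unfolding eq using a by (intro nn_integral_cong ennreal_mult) (auto simp: C_def)
  also have "\<dots> = ennreal C"
    by (simp add: nn_integral_cmult nn_integral_normal_density \<sigma>)
  finally show ?thesis by (simp add: C_def a_def)
qed

lemma nn_integral_heat_kernel:
  assumes "0 < t"
  shows "(\<integral>\<^sup>+r. ennreal (heat_kernel t (x - r)) \<partial>lborel) = 1"
  using nn_integral_heat_kernel_exp_square[of t 0 x] assms by simp

text \<open>At the critical time the Gaussian decay cancels the growth of
  \<open>exp (l * r^2)\<close> exactly, so the integrand is a positive constant on the whole
  line.\<close>

lemma nn_integral_heat_kernel_exp_square_critical:
  assumes "0 < l"
  shows "(\<integral>\<^sup>+r. ennreal (heat_kernel (1 / (4 * l)) (- r) * exp (l * r\<^sup>2)) \<partial>lborel) = \<infinity>"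
proof -
  have eq: "heat_kernel (1 / (4 * l)) (- r) * exp (l * r\<^sup>2) = sqrt (l / pi)" for r
    using assms
    by (simp add: heat_kernel_def exp_minus real_sqrt_divide real_sqrt_mult field_simps)
  show ?thesis
    unfolding eq using assms by (simp add: ennreal_mult_top)
qed

section \<open>The Neumann Green function\<close>

lemma closure_half_space:
  fixes k :: "'n::finite"
  shows "closure (half_space k) = {y. 0 \<le> y $ k}"
proof -
  have *: "(axis k 1 :: real ^ 'n) \<noteq> 0" by (simp add: axis_eq_0_iff)
  show ?thesis
    using closure_halfspace_gt[OF *, of 0] by (simp add: half_space_def inner_axis')
qed

lemma bdry_pt_nth_self [simp]: "bdry_pt k z $ k = 0"
  by (simp add: bdry_pt_def)

lemma bdry_pt_in_closure: "bdry_pt k z \<in> closure (half_space k)"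
  by (simp add: closure_half_space)

lemma reflect_bdry_pt [simp]: "reflect k (bdry_pt k z) = bdry_pt k z"
  by (simp add: reflect_def bdry_pt_def vec_eq_iff)

text \<open>The squared norm is a sum over coordinates and the normalising factor is the N-th power
  of \<open>1 / sqrt (4 * pi * t)\<close>. This factorisation is what allows coordinatewise
  integration.\<close>

lemma gaussian_eq_prod_heat_kernel:
  fixes z :: "real ^ 'n"
  assumes "0 < t"
  shows "(4 * pi * t) powr (- (real CARD('n) / 2)) * exp (- ((norm z)\<^sup>2 / (4 * t)))
    = (\<Prod>i\<in>UNIV. heat_kernel t (z $ i))"
proof -
  have "(norm z)\<^sup>2 = (\<Sum>i\<in>UNIV. (z $ i)\<^sup>2)"
    by (simp add: norm_vec_def L2_set_def sum_nonneg)
  then have "exp (- ((norm z)\<^sup>2 / (4 * t))) = (\<Prod>i\<in>UNIV. exp (- ((z $ i)\<^sup>2 / (4 * t))))"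
    by (simp add: exp_sum[symmetric] sum_divide_distrib sum_negf)
  moreover have "(4 * pi * t) powr (- (real CARD('n) / 2)) = (1 / sqrt (4 * pi * t)) ^ CARD('n)"
  proof -
    have "(4 * pi * t) powr (- (real CARD('n) / 2))
        = ((4 * pi * t) powr (- (1 / 2))) powr real CARD('n)"
      by (simp add: powr_powr)
    also have "\<dots> = (1 / sqrt (4 * pi * t)) ^ CARD('n)"
      using assms by (simp add: powr_realpow powr_minus powr_half_sqrt inverse_eq_divide)
    finally show ?thesis .
  qed
  ultimately show ?thesis
    by (simp add: heat_kernel_def prod_dividef power_one_over)
qed

lemma neumann_green_eq_prod:
  fixes x y :: "real ^ 'n"
  assumes "0 < t"
  shows "neumann_green k x y t = (\<Prod>i\<in>UNIV. heat_kernel t (x $ i - y $ i))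
    + (\<Prod>i\<in>UNIV. heat_kernel t (x $ i - reflect k y $ i))"
  unfolding neumann_green_def distrib_left gaussian_eq_prod_heat_kernel[OF assms]
  by simp

lemma neumann_green_nonneg: "0 < t \<Longrightarrow> 0 \<le> neumann_green k x y t"
  by (simp add: neumann_green_def)

section \<open>Integrating out the tangential variables\<close>

lemma nn_integral_lborel_vec_prod:
  fixes f :: "'n::finite \<Rightarrow> real \<Rightarrow> ennreal"
  assumes "\<And>i. f i \<in> borel_measurable borel"
  shows "(\<integral>\<^sup>+y. (\<Prod>i\<in>UNIV. f i (y $ i)) \<partial>(lborel :: (real ^ 'n) measure))
    = (\<Prod>i\<in>UNIV. \<integral>\<^sup>+r. f i r \<partial>lborel)"
proof -
  \<comment> \<open>Fubini for \<open>lborel\<close> runs over the basis vectors; \<open>idx\<close>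
    recovers the coordinate \<open>i\<close> from \<open>axis i 1\<close>.\<close>
  define idx :: "real ^ 'n \<Rightarrow> 'n" where "idx b = (THE i. b = axis i 1)" for b
  have idx: "idx (axis i 1) = i" for i
    by (simp add: idx_def axis_eq_axis)
  have Basis: "(Basis :: (real ^ 'n) set) = (\<lambda>i. axis i 1) ` UNIV"
    by (auto simp: Basis_vec_def)
  have inj: "inj (\<lambda>i::'n. axis i (1::real))"
    by (auto simp: inj_on_def axis_eq_axis)
  have "(\<integral>\<^sup>+y. (\<Prod>b\<in>Basis. f (idx b) (y \<bullet> b)) \<partial>(lborel :: (real ^ 'n) measure))
    = (\<Prod>b\<in>(Basis :: (real ^ 'n) set). \<integral>\<^sup>+r. f (idx b) r \<partial>lborel)"
    by (rule nn_integral_lborel_prod) (simp_all add: assms)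
  then show ?thesis
    by (simp add: Basis prod.reindex[OF inj] idx inner_axis)
qed

text \<open>Each tangential heat kernel has total mass one, so only the integral in the normal
  coordinate \<open>k\<close> survives.\<close>

lemma nn_integral_vec_heat_kernel:
  fixes x :: "real ^ 'n" and g :: "real \<Rightarrow> ennreal"
  assumes t: "0 < t" and [measurable]: "g \<in> borel_measurable borel"
  shows "(\<integral>\<^sup>+y. ennreal (\<Prod>i\<in>UNIV - {k}. heat_kernel t (x $ i - y $ i)) * g (y $ k)
      \<partial>(lborel :: (real ^ 'n) measure)) = (\<integral>\<^sup>+r. g r \<partial>lborel)"
proof -
  \<comment> \<open>Putting \<open>g\<close> into slot \<open>k\<close> makes the integrand a full
    product over all coordinates.\<close>
  define F where "F i r = (if i = k then g r else ennreal (heat_kernel t (x $ i - r)))" for i r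
  have F: "F k = g" "\<And>i. i \<in> UNIV - {k} \<Longrightarrow> F i = (\<lambda>r. ennreal (heat_kernel t (x $ i - r)))"
    by (auto simp: F_def)
  have [measurable]: "F i \<in> borel_measurable borel" for i
    by (cases "i = k") (simp_all add: F_def[abs_def])
  have "ennreal (\<Prod>i\<in>UNIV - {k}. heat_kernel t (x $ i - y $ i)) * g (y $ k)
      = (\<Prod>i\<in>UNIV. F i (y $ i))" for y
  proof -
    have "(\<Prod>i\<in>UNIV. F i (y $ i)) = F k (y $ k) * (\<Prod>i\<in>UNIV - {k}. F i (y $ i))"
      by (rule prod.remove) auto
    then show ?thesis
      using t by (simp add: F prod_ennreal mult.commute)
  qed
  then have "(\<integral>\<^sup>+y. ennreal (\<Prod>i\<in>UNIV - {k}. heat_kernel t (x $ i - y $ i)) * g (y $ k)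
      \<partial>(lborel :: (real ^ 'n) measure)) = (\<Prod>i\<in>UNIV. \<integral>\<^sup>+r. F i r \<partial>lborel)"
    by (simp add: nn_integral_lborel_vec_prod)
  also have "\<dots> = (\<integral>\<^sup>+r. F k r \<partial>lborel) * (\<Prod>i\<in>UNIV - {k}. \<integral>\<^sup>+r. F i r \<partial>lborel)"
    by (rule prod.remove) auto
  finally show ?thesis
    using t by (simp add: F nn_integral_heat_kernel)
qed

text \<open>Even reflection of the datum turns the half-space integral into a whole-line one.\<close>

lemma nn_integral_neumann_green_half_space:
  fixes x :: "real ^ 'n" and f :: "real \<Rightarrow> real"
  assumes t: "0 < t" and [measurable]: "f \<in> borel_measurable borel" and f: "\<And>r. 0 \<le> f r"
    and even: "\<And>r. f (- r) = f r"
  shows "(\<integral>\<^sup>+y\<in>closure (half_space k). ennreal (neumann_green k x y t * f (y $ k)) \<partial>lebesgue)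
    = (\<integral>\<^sup>+r. ennreal (heat_kernel t (x $ k - r) * f r) \<partial>lborel)"
proof -
  \<comment> \<open>Reflection changes coordinate \<open>k\<close> only, so both Gaussians share the
    tangential factor \<open>P\<close>. Below, \<open>g\<close> is the normal factor of the source
    and \<open>h\<close> that of its mirror image.\<close>
  define P where "P y = (\<Prod>i\<in>UNIV - {k}. heat_kernel t (x $ i - y $ i))" for y :: "real ^ 'n"
  have P: "0 \<le> P y" for y using t by (auto simp: P_def intro!: prod_nonneg)
  define g where "g r = ennreal (heat_kernel t (x $ k - r) * f r) * indicator {0..} r" for r
  define h where "h r = ennreal (heat_kernel t (x $ k + r) * f r) * indicator {0..} r" for r
  have [measurable]: "g \<in> borel_measurable borel" "h \<in> borel_measurable borel"
    unfolding g_def h_def by measurable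
  have [measurable]: "P \<in> borel_measurable borel"
    unfolding P_def by measurable
  have green: "neumann_green k x y t = P y * heat_kernel t (x $ k - y $ k)
      + P y * heat_kernel t (x $ k + y $ k)" for y
  proof -
    have "(\<Prod>i\<in>UNIV. heat_kernel t (x $ i - y $ i)) = heat_kernel t (x $ k - y $ k) * P y"
      unfolding P_def by (rule prod.remove) auto
    moreover have "(\<Prod>i\<in>UNIV. heat_kernel t (x $ i - reflect k y $ i))
        = heat_kernel t (x $ k - reflect k y $ k)
          * (\<Prod>i\<in>UNIV - {k}. heat_kernel t (x $ i - reflect k y $ i))"
      by (rule prod.remove) auto
    ultimately show ?thesis
      unfolding neumann_green_eq_prod[OF t] by (simp add: reflect_def P_def)
  qed
  have "ennreal (neumann_green k x y t * f (y $ k)) * indicator (closure (half_space k)) y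
      = ennreal (P y) * g (y $ k) + ennreal (P y) * h (y $ k)" for y
    using P t f
    by (auto simp: green g_def h_def closure_half_space indicator_def ennreal_mult'[symmetric]
        ennreal_plus[symmetric] algebra_simps simp del: ennreal_plus)
  then have "(\<integral>\<^sup>+y\<in>closure (half_space k). ennreal (neumann_green k x y t * f (y $ k)) \<partial>lebesgue)
      = (\<integral>\<^sup>+y. ennreal (P y) * g (y $ k) \<partial>lborel) + (\<integral>\<^sup>+y. ennreal (P y) * h (y $ k) \<partial>lborel)"
    by (simp add: nn_integral_completion nn_integral_add)
  also have "\<dots> = (\<integral>\<^sup>+r. g r \<partial>lborel) + (\<integral>\<^sup>+r. h r \<partial>lborel)"
    unfolding P_def using t by (simp add: nn_integral_vec_heat_kernel)
  \<comment> \<open>After \<open>r\<close> is replaced by \<open>- r\<close>, evenness of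
    \<open>f\<close> makes the image term the integrand of \<open>g\<close> on the negative half
    line; the two pieces overlap only in the null set \<open>{0}\<close>.\<close>
  also have "(\<integral>\<^sup>+r. h r \<partial>lborel) = (\<integral>\<^sup>+r. h (- r) \<partial>lborel)"
    using nn_integral_real_affine[of h "-1" 0] by simp
  also have "(\<integral>\<^sup>+r. g r \<partial>lborel) + (\<integral>\<^sup>+r. h (- r) \<partial>lborel) = (\<integral>\<^sup>+r. g r + h (- r) \<partial>lborel)"
    by (simp add: nn_integral_add)
  also have "\<dots> = (\<integral>\<^sup>+r. ennreal (heat_kernel t (x $ k - r) * f r) \<partial>lborel)"
    using AE_lborel_singleton[of "0::real"]
    by (intro nn_integral_cong_AE) (auto simp: g_def h_def even indicator_def elim!: eventually_mono)
  finally show ?thesis .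
qed

text \<open>A boundary point is its own mirror image, whence the factor 2; the tangential Gaussians
  integrate to one.\<close>

lemma nn_integral_neumann_green_bdry:
  fixes x :: "real ^ 'n"
  assumes t: "0 < t" and c: "0 \<le> c"
  shows "(\<integral>\<^sup>+z. ennreal (neumann_green k x (bdry_pt k z) t * c) \<partial>(\<Pi>\<^sub>M i\<in>- {k}. lborel))
    = ennreal (2 * heat_kernel t (x $ k) * c)"
proof -
  interpret product_sigma_finite "\<lambda>i::'n. lborel :: real measure" ..
  have "neumann_green k x (bdry_pt k z) t
      = 2 * heat_kernel t (x $ k) * (\<Prod>i\<in>- {k}. heat_kernel t (x $ i - z i))" for z
  proof -
    have "(\<Prod>i\<in>UNIV. heat_kernel t (x $ i - bdry_pt k z $ i)) = heat_kernel t (x $ k - bdry_pt k z $ k)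
        * (\<Prod>i\<in>UNIV - {k}. heat_kernel t (x $ i - bdry_pt k z $ i))"
      by (rule prod.remove) auto
    also have "(\<Prod>i\<in>UNIV - {k}. heat_kernel t (x $ i - bdry_pt k z $ i))
        = (\<Prod>i\<in>- {k}. heat_kernel t (x $ i - z i))"
      by (rule prod.cong) (auto simp: bdry_pt_def)
    finally show ?thesis
      unfolding neumann_green_eq_prod[OF t] by simp
  qed
  then have "ennreal (neumann_green k x (bdry_pt k z) t * c)
      = ennreal (2 * heat_kernel t (x $ k) * c) * (\<Prod>i\<in>- {k}. ennreal (heat_kernel t (x $ i - z i)))" for z
    using t c by (simp add: prod_ennreal ennreal_mult'[symmetric] mult_ac)
  then have "(\<integral>\<^sup>+z. ennreal (neumann_green k x (bdry_pt k z) t * c) \<partial>(\<Pi>\<^sub>M i\<in>- {k}. lborel))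
      = ennreal (2 * heat_kernel t (x $ k) * c)
        * (\<integral>\<^sup>+z. (\<Prod>i\<in>- {k}. ennreal (heat_kernel t (x $ i - z i))) \<partial>(\<Pi>\<^sub>M i\<in>- {k}. lborel))"
    by (simp add: nn_integral_cmult)
  also have "(\<integral>\<^sup>+z. (\<Prod>i\<in>- {k}. ennreal (heat_kernel t (x $ i - z i))) \<partial>(\<Pi>\<^sub>M i\<in>- {k}. lborel)) = 1"
    using t by (subst product_nn_integral_prod) (auto simp: nn_integral_heat_kernel)
  finally show ?thesis by simp
qed

section \<open>The boundary potential\<close>

text \<open>The substitution \<open>s = t \<sigma>\<close> moves the time variable out of the domain of integration, so that
  joint continuity follows from dominated convergence.\<close>

definition bdry_kernel :: "real \<Rightarrow> real \<Rightarrow> real \<Rightarrow> real" where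
  "bdry_kernel r t \<sigma> = 2 * t * heat_kernel (t * (1 - \<sigma>)) r"

text \<open>With \<open>s = t * \<sigma>\<close> undone, this is the single-layer heat potential of
  a density depending on time only: the integral of \<open>2 * heat_kernel (t - s) r * g s\<close>
  over \<open>0 < s < t\<close>, at normal coordinate \<open>r\<close>. The factor \<open>t\<close>
  in the kernel is the Jacobian.\<close>

definition bdry_potential :: "(real \<Rightarrow> real) \<Rightarrow> real \<Rightarrow> real \<Rightarrow> real" where
  "bdry_potential g r t = (LINT \<sigma>:{0<..<1}|lborel. bdry_kernel r t \<sigma> * g (t * \<sigma>))"

lemma bdry_kernel_nonneg: "0 < t \<Longrightarrow> \<sigma> < 1 \<Longrightarrow> 0 \<le> bdry_kernel r t \<sigma>"
  by (simp add: bdry_kernel_def)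

text \<open>Dropping the exponential leaves an integrable singularity at
  \<open>\<sigma> = 1\<close>, uniform in \<open>r\<close> and in \<open>t \<le> T\<close>; it
  serves as dominating function below.\<close>

lemma bdry_kernel_le:
  assumes "0 < t" "t \<le> T" "\<sigma> < 1"
  shows "bdry_kernel r t \<sigma> \<le> sqrt (T / pi) * (1 / sqrt (1 - \<sigma>))"
proof -
  have "bdry_kernel r t \<sigma> = sqrt (t / pi) * (exp (- (r\<^sup>2 / (4 * (t * (1 - \<sigma>))))) / sqrt (1 - \<sigma>))"
  proof -
    have "sqrt (4 * pi * (t * (1 - \<sigma>))) = 2 * sqrt pi * sqrt t * sqrt (1 - \<sigma>)"
      by (simp add: real_sqrt_mult)
    moreover have "t = sqrt t * sqrt t" using assms by simp
    ultimately show ?thesis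
      using assms by (simp add: bdry_kernel_def heat_kernel_def real_sqrt_divide divide_simps)
  qed
  also have "\<dots> \<le> sqrt (T / pi) * (1 / sqrt (1 - \<sigma>))"
    using assms by (intro mult_mono divide_right_mono real_sqrt_le_mono) auto
  finally show ?thesis .
qed

lemma continuous_on_bdry_kernel:
  "continuous_on {(r, t, \<sigma>). 0 < t \<and> \<sigma> < 1} (\<lambda>(r, t, \<sigma>). bdry_kernel r t \<sigma>)"
  unfolding bdry_kernel_def heat_kernel_def case_prod_unfold
  by (intro continuous_intros) auto

text \<open>The antiderivative \<open>- 2 * sqrt (1 - \<sigma>)\<close> has one-sided limits
  \<open>- 2\<close> and \<open>0\<close>. The fundamental theorem for nonnegative integrands on
  open intervals gives integrability and value together, despite the singular endpoint.\<close>

lemma inverse_sqrt_integral: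
  shows set_integrable_inverse_sqrt: "set_integrable lborel {0<..<1} (\<lambda>\<sigma>::real. 1 / sqrt (1 - \<sigma>))"
    and set_integral_inverse_sqrt: "(LINT \<sigma>:{0<..<1}|lborel. 1 / sqrt (1 - \<sigma>)) = (2::real)"
proof -
  have ivl: "einterval 0 1 = {0<..<1::real}"
    by (auto simp: einterval_def zero_ereal_def one_ereal_def)
  have D: "DERIV (\<lambda>\<sigma>. - 2 * sqrt (1 - \<sigma>)) x :> 1 / sqrt (1 - x)" if "0 < ereal x" "ereal x < 1" for x
    using that by (auto intro!: derivative_eq_intros simp: zero_ereal_def one_ereal_def field_simps)
  have C: "isCont (\<lambda>\<sigma>. 1 / sqrt (1 - \<sigma>)) x" if "0 < ereal x" "ereal x < 1" for x
    using that by (auto intro!: continuous_intros simp: zero_ereal_def one_ereal_def)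
  have A: "(((\<lambda>\<sigma>. - 2 * sqrt (1 - \<sigma>)) \<circ> real_of_ereal) \<longlongrightarrow> - 2) (at_right 0)"
  proof -
    have "((\<lambda>\<sigma>::real. - 2 * sqrt (1 - \<sigma>)) \<longlongrightarrow> - 2 * sqrt (1 - 0)) (at_right 0)"
      by (intro tendsto_intros)
    then show ?thesis
      by (simp add: zero_ereal_def ereal_tendsto_simps)
  qed
  have B: "(((\<lambda>\<sigma>. - 2 * sqrt (1 - \<sigma>)) \<circ> real_of_ereal) \<longlongrightarrow> 0) (at_left 1)"
  proof -
    have "((\<lambda>\<sigma>::real. - 2 * sqrt (1 - \<sigma>)) \<longlongrightarrow> - 2 * sqrt (1 - 1)) (at_left 1)"
      by (intro tendsto_intros)
    then show ?thesis
      by (simp add: one_ereal_def ereal_tendsto_simps)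
  qed
  have nn: "AE x in lborel. 0 < ereal x \<longrightarrow> ereal x < 1 \<longrightarrow> 0 \<le> 1 / sqrt (1 - x)"
    by (auto simp: one_ereal_def)
  note FTC = interval_integral_FTC_nonneg[OF _ D C nn A B]
  show "set_integrable lborel {0<..<1} (\<lambda>\<sigma>::real. 1 / sqrt (1 - \<sigma>))"
    using FTC(1) by (simp add: ivl)
  show "(LINT \<sigma>:{0<..<1}|lborel. 1 / sqrt (1 - \<sigma>)) = (2::real)"
    using FTC(2) by (simp add: interval_lebesgue_integral_def ivl)
qed

section \<open>Potentials of bounded continuous densities\<close>

context
  fixes T C :: real and g :: "real \<Rightarrow> real"
  assumes cont: "continuous_on {0<..<T} g" and bound: "\<And>s. s \<in> {0<..<T} \<Longrightarrow> \<bar>g s\<bar> \<le> C"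
begin

lemma time_scaling_mem: "0 < t \<Longrightarrow> t < T \<Longrightarrow> \<sigma> \<in> {0<..<1} \<Longrightarrow> t * \<sigma> \<in> {0<..<T}"
  using mult_strict_left_mono[of \<sigma> 1 t] less_trans[of "t * \<sigma>" t T] by simp

lemma bdry_potential_measurable:
  assumes t: "0 < t" "t < T"
  shows "(\<lambda>\<sigma>. indicator {0<..<1} \<sigma> *\<^sub>R (bdry_kernel r t \<sigma> * g (t * \<sigma>))) \<in> borel_measurable borel"
proof (rule borel_measurable_continuous_on_indicator)
  have "continuous_on {0<..<1} ((\<lambda>(r, t, \<sigma>). bdry_kernel r t \<sigma>) \<circ> (\<lambda>\<sigma>. (r, t, \<sigma>)))"
    using t by (intro continuous_on_compose continuous_on_subset[OF continuous_on_bdry_kernel]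
        continuous_intros) auto
  moreover have "continuous_on {0<..<1} (g \<circ> (\<lambda>\<sigma>. t * \<sigma>))"
    using t by (intro continuous_on_compose continuous_on_subset[OF cont] continuous_intros)
      (auto dest: time_scaling_mem)
  ultimately show "continuous_on {0<..<1} (\<lambda>\<sigma>. bdry_kernel r t \<sigma> * g (t * \<sigma>))"
    by (auto simp: o_def intro: continuous_on_mult)
qed auto

text \<open>The free parameter \<open>S\<close> is \<open>t\<close> when only integrability matters
  and \<open>T\<close> when the bound must be uniform in time.\<close>

lemma bdry_potential_dominated:
  assumes t: "0 < t" "t < T" and S: "t \<le> S"
  shows "\<bar>indicator {0<..<1} \<sigma> *\<^sub>R (bdry_kernel r t \<sigma> * g (t * \<sigma>))\<bar>
    \<le> indicator {0<..<1} \<sigma> *\<^sub>R (sqrt (S / pi) * C * (1 / sqrt (1 - \<sigma>)))"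
proof (cases "\<sigma> \<in> {0<..<1}")
  case True
  then have "\<bar>g (t * \<sigma>)\<bar> \<le> C" using bound time_scaling_mem t by blast
  then have "bdry_kernel r t \<sigma> * \<bar>g (t * \<sigma>)\<bar> \<le> (sqrt (S / pi) * (1 / sqrt (1 - \<sigma>))) * C"
    using True t S bdry_kernel_nonneg[of t \<sigma> r]
    by (intro mult_mono bdry_kernel_le) auto
  then show ?thesis
    using True t bdry_kernel_nonneg[of t \<sigma> r] by (simp add: abs_mult mult_ac)
qed simp

lemma dominating_integrable: "integrable lborel
    (\<lambda>\<sigma>. indicator {0<..<1} \<sigma> *\<^sub>R (sqrt (S / pi) * C * (1 / sqrt (1 - \<sigma>))))"
  using set_integrable_mult_right[OF set_integrable_inverse_sqrt, of "sqrt (S / pi) * C"]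
  unfolding set_integrable_def by simp

lemma bdry_potential_integrable:
  assumes t: "0 < t" "t < T"
  shows "set_integrable lborel {0<..<1} (\<lambda>\<sigma>. bdry_kernel r t \<sigma> * g (t * \<sigma>))"
  unfolding set_integrable_def
proof (rule Bochner_Integration.integrable_bound[OF dominating_integrable[of t]])
  show "AE \<sigma> in lborel. norm (indicator {0<..<1} \<sigma> *\<^sub>R (bdry_kernel r t \<sigma> * g (t * \<sigma>)))
      \<le> norm (indicator {0<..<1} \<sigma> *\<^sub>R (sqrt (t / pi) * C * (1 / sqrt (1 - \<sigma>))))"
    unfolding real_norm_def
    by (intro AE_I2 order_trans[OF bdry_potential_dominated[OF t order_refl] abs_ge_self])
qed (use bdry_potential_measurable[OF t] in simp)

text \<open>The factor 2 is the integral of \<open>1 / sqrt (1 - \<sigma>)\<close> over the unit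
  interval.\<close>

lemma abs_bdry_potential_le:
  assumes t: "0 < t" "t < T"
  shows "\<bar>bdry_potential g r t\<bar> \<le> 2 * sqrt (T / pi) * C"
proof -
  let ?F = "\<lambda>\<sigma>. indicator {0<..<1} \<sigma> *\<^sub>R (bdry_kernel r t \<sigma> * g (t * \<sigma>))"
  have "\<bar>bdry_potential g r t\<bar> \<le> (LINT \<sigma>|lborel. \<bar>?F \<sigma>\<bar>)"
    unfolding bdry_potential_def set_lebesgue_integral_def by (rule integral_abs_bound)
  also have "\<dots>
      \<le> (LINT \<sigma>|lborel. indicator {0<..<1} \<sigma> *\<^sub>R (sqrt (T / pi) * C * (1 / sqrt (1 - \<sigma>))))"
    by (intro integral_mono integrable_abs bdry_potential_integrable[OF t, unfolded set_integrable_def]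
        dominating_integrable bdry_potential_dominated[OF t less_imp_le[OF t(2)]])
  also have "\<dots> = sqrt (T / pi) * C * (LINT \<sigma>:{0<..<1}|lborel. 1 / sqrt (1 - \<sigma>))"
    by (subst set_integral_mult_right[symmetric]) (simp add: set_lebesgue_integral_def)
  finally show ?thesis by (simp add: set_integral_inverse_sqrt)
qed

text \<open>Along a convergent sequence the integrands converge for each fixed
  \<open>\<sigma>\<close>, and all are dominated by the bound with \<open>S = T\<close>.\<close>

lemma continuous_on_bdry_potential:
  "continuous_on (UNIV \<times> {0<..<T}) (\<lambda>(r, t). bdry_potential g r t)"
  unfolding continuous_on_sequentially
proof (intro ballI allI impI)
  fix x :: "nat \<Rightarrow> real \<times> real" and a
  assume a: "a \<in> UNIV \<times> {0<..<T}" and x: "(\<forall>n. x n \<in> UNIV \<times> {0<..<T}) \<and> x \<longlonglongrightarrow> a"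
  have x': "0 < snd (x n)" "snd (x n) < T" for n
    using x by (auto simp: mem_Times_iff)
  have a': "0 < snd a" "snd a < T" using a by (auto simp: mem_Times_iff)
  have lim: "(\<lambda>n. fst (x n)) \<longlonglongrightarrow> fst a" "(\<lambda>n. snd (x n)) \<longlonglongrightarrow> snd a"
    using x by (auto intro: tendsto_fst tendsto_snd)
  have pointwise: "(\<lambda>n. bdry_kernel (fst (x n)) (snd (x n)) \<sigma> * g (snd (x n) * \<sigma>))
      \<longlonglongrightarrow> bdry_kernel (fst a) (snd a) \<sigma> * g (snd a * \<sigma>)" if \<sigma>: "\<sigma> \<in> {0<..<1}" for \<sigma>
  proof (rule tendsto_mult)
    have "(\<lambda>n. (\<lambda>(r, t, \<sigma>). bdry_kernel r t \<sigma>) (fst (x n), snd (x n), \<sigma>))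
        \<longlonglongrightarrow> (\<lambda>(r, t, \<sigma>). bdry_kernel r t \<sigma>) (fst a, snd a, \<sigma>)"
      using \<sigma> a' x'
      by (intro continuous_on_tendsto_compose[OF continuous_on_bdry_kernel] tendsto_intros lim) auto
    then show "(\<lambda>n. bdry_kernel (fst (x n)) (snd (x n)) \<sigma>) \<longlonglongrightarrow> bdry_kernel (fst a) (snd a) \<sigma>"
      by simp
    show "(\<lambda>n. g (snd (x n) * \<sigma>)) \<longlonglongrightarrow> g (snd a * \<sigma>)"
      using \<sigma> a' x' time_scaling_mem
      by (intro continuous_on_tendsto_compose[OF cont] tendsto_intros lim always_eventually allI) auto
  qed
  have "(\<lambda>n. bdry_potential g (fst (x n)) (snd (x n))) \<longlonglongrightarrow> bdry_potential g (fst a) (snd a)"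
    unfolding bdry_potential_def set_lebesgue_integral_def
  proof (rule integral_dominated_convergence[OF _ _ dominating_integrable[of T]])
    show "AE \<sigma> in lborel. (\<lambda>n. indicator {0<..<1} \<sigma> *\<^sub>R
          (bdry_kernel (fst (x n)) (snd (x n)) \<sigma> * g (snd (x n) * \<sigma>)))
        \<longlonglongrightarrow> indicator {0<..<1} \<sigma> *\<^sub>R (bdry_kernel (fst a) (snd a) \<sigma> * g (snd a * \<sigma>))"
      using pointwise by (auto simp: indicator_def)
    show "AE \<sigma> in lborel. norm (indicator {0<..<1} \<sigma> *\<^sub>R
          (bdry_kernel (fst (x n)) (snd (x n)) \<sigma> * g (snd (x n) * \<sigma>)))
        \<le> indicator {0<..<1} \<sigma> *\<^sub>R (sqrt (T / pi) * C * (1 / sqrt (1 - \<sigma>)))" for n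
      unfolding real_norm_def
      by (intro AE_I2 bdry_potential_dominated x' less_imp_le)
  qed (use bdry_potential_measurable[OF a'] bdry_potential_measurable[OF x'] in simp_all)
  then show "((\<lambda>(r, t). bdry_potential g r t) \<circ> x) \<longlonglongrightarrow> (\<lambda>(r, t). bdry_potential g r t) a"
    by (simp add: o_def case_prod_unfold)
qed

lemma bdry_potential_nonneg:
  assumes "0 < t" "t < T" "\<And>s. s \<in> {0<..<T} \<Longrightarrow> 0 \<le> g s"
  shows "0 \<le> bdry_potential g r t"
  unfolding bdry_potential_def set_lebesgue_integral_def
  using assms bdry_kernel_nonneg time_scaling_mem
  by (intro Bochner_Integration.integral_nonneg) (auto simp: indicator_def)

text \<open>The substitution \<open>s = t * \<sigma>\<close>, read backwards, links the Bochner
  integral used for estimates to the extended nonnegative integral in the notion of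
  solution.\<close>

lemma ennreal_bdry_potential:
  assumes t: "0 < t" "t < T" and nn: "\<And>s. s \<in> {0<..<T} \<Longrightarrow> 0 \<le> g s"
  shows "ennreal (bdry_potential g r t)
    = (\<integral>\<^sup>+s\<in>{0<..<t}. ennreal (2 * heat_kernel (t - s) r * g s) \<partial>lborel)"
proof -
  define F where "F s = indicator {0<..<t} s *\<^sub>R (2 * heat_kernel (t - s) r * g s)" for s
  have "continuous_on {0<..<t} (\<lambda>s. 2 * heat_kernel (t - s) r * g s)"
    unfolding heat_kernel_def using t
    by (intro continuous_intros continuous_on_subset[OF cont]) auto
  then have [measurable]: "F \<in> borel_measurable borel"
    unfolding F_def by (intro borel_measurable_continuous_on_indicator) auto
  have "(\<integral>\<^sup>+s\<in>{0<..<t}. ennreal (2 * heat_kernel (t - s) r * g s) \<partial>lborel)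
      = (\<integral>\<^sup>+s. ennreal (F s) \<partial>lborel)"
    by (intro nn_integral_cong) (auto simp: F_def indicator_def)
  also have "\<dots> = ennreal t * (\<integral>\<^sup>+\<sigma>. ennreal (F (0 + t * \<sigma>)) \<partial>lborel)"
    using t by (subst nn_integral_real_affine[where c = t and t = 0]) auto
  also have "\<dots> = (\<integral>\<^sup>+\<sigma>. ennreal (t * F (0 + t * \<sigma>)) \<partial>lborel)"
    using t by (subst nn_integral_cmult[symmetric]) (auto simp: ennreal_mult')
  also have "\<dots> = (\<integral>\<^sup>+\<sigma>. ennreal (indicator {0<..<1} \<sigma> *\<^sub>R (bdry_kernel r t \<sigma> * g (t * \<sigma>))) \<partial>lborel)"
    using t by (intro nn_integral_cong)
      (auto simp: F_def indicator_def bdry_kernel_def zero_less_mult_iff right_diff_distrib mult_ac)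
  also have "\<dots> = ennreal (bdry_potential g r t)"
    unfolding bdry_potential_def set_lebesgue_integral_def
    using t nn bdry_kernel_nonneg time_scaling_mem
    by (intro nn_integral_eq_integral bdry_potential_integrable[unfolded set_integrable_def])
      (auto simp: indicator_def)
  finally show ?thesis ..
qed

end

lemma abs_bdry_potential_diff_le:
  assumes "continuous_on {0<..<T} f" "\<And>s. s \<in> {0<..<T} \<Longrightarrow> \<bar>f s\<bar> \<le> A"
    and "continuous_on {0<..<T} g" "\<And>s. s \<in> {0<..<T} \<Longrightarrow> \<bar>g s\<bar> \<le> A"
    and diff: "\<And>s. s \<in> {0<..<T} \<Longrightarrow> \<bar>f s - g s\<bar> \<le> C" and t: "0 < t" "t < T"
  shows "\<bar>bdry_potential f r t - bdry_potential g r t\<bar> \<le> 2 * sqrt (T / pi) * C"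
proof -
  have "bdry_potential f r t - bdry_potential g r t = bdry_potential (\<lambda>s. f s - g s) r t"
    unfolding bdry_potential_def right_diff_distrib
    using set_integral_diff(2)[OF bdry_potential_integrable[OF assms(1,2) t]
        bdry_potential_integrable[OF assms(3,4) t], of r r] by simp
  also have "\<bar>\<dots>\<bar> \<le> 2 * sqrt (T / pi) * C"
    using assms by (intro abs_bdry_potential_le continuous_on_diff) auto
  finally show ?thesis .
qed

section \<open>The integral equation on the boundary\<close>

text \<open>By the mean value theorem: on the interval from 0 to \<open>M\<close> the derivative
  \<open>p * x powr (p - 1)\<close> is at most its value at \<open>M\<close>.\<close>

lemma abs_powr_diff_le:
  fixes a b :: real
  assumes p: "1 < p" and a: "0 \<le> a" "a \<le> M" and b: "0 \<le> b" "b \<le> M"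
  shows "\<bar>a powr p - b powr p\<bar> \<le> p * M powr (p - 1) * \<bar>a - b\<bar>"
  using a b
proof (induction a b rule: linorder_wlog)
  case (le a b)
  show ?case
  proof (cases "a = b")
    case False
    \<comment> \<open>Only \<open>x > a \<ge> 0\<close> is considered, so the base is positive; at
      the endpoint \<open>a\<close>, possibly 0, continuity suffices.\<close>
    have deriv: "((\<lambda>x. x powr p) has_real_derivative p * x powr (p - 1)) (at x)" if "a < x" for x
      using le that by (auto intro!: derivative_eq_intros)
    have "continuous_on {a..b} (\<lambda>x. x powr p)"
      using le p by (intro continuous_on_powr' continuous_intros) auto
    then obtain D z where z: "a < z" "z < b" "DERIV (\<lambda>x. x powr p) z :> D"
        "b powr p - a powr p = (b - a) * D"
      using MVT[of a b "\<lambda>x. x powr p"] False le deriv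
      by (metis order_less_le real_differentiable_def)
    have "D = p * z powr (p - 1)"
      using DERIV_unique[OF z(3) deriv[OF z(1)]] .
    also have "\<dots> \<le> p * M powr (p - 1)"
      using p z le by (intro mult_left_mono powr_mono2) auto
    finally have "(b - a) * D \<le> (b - a) * (p * M powr (p - 1))"
      using le by (intro mult_left_mono) auto
    moreover have "0 \<le> b powr p - a powr p"
      using le p by (simp add: powr_mono2)
    ultimately show ?thesis
      using z(4) le by (simp add: mult_ac abs_minus_commute)
  qed simp
qed (simp add: abs_minus_commute)

section \<open>Picard iteration for the boundary values\<close>

fun picard :: "(real \<Rightarrow> real) \<Rightarrow> real \<Rightarrow> nat \<Rightarrow> real \<Rightarrow> real" where
  "picard h p 0 t = 0"
| "picard h p (Suc n) t = h t + bdry_potential (\<lambda>s. picard h p n s powr p) 0 t"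

context
  fixes h :: "real \<Rightarrow> real" and p T M :: real
  assumes p: "1 < p" and T: "0 < T" and M: "0 < M"
    and h_cont: "continuous_on {0<..<T} h"
    and h_bounds: "\<And>t. t \<in> {0<..<T} \<Longrightarrow> 0 \<le> h t \<and> h t \<le> M / 2"
    and contraction: "2 * sqrt (T / pi) * (p * M powr (p - 1)) \<le> 1 / 2"
begin

lemma powr_cont:
  fixes f :: "real \<Rightarrow> real"
  assumes "continuous_on {0<..<T} f" "\<And>s. s \<in> {0<..<T} \<Longrightarrow> 0 \<le> f s"
  shows "continuous_on {0<..<T} (\<lambda>s. f s powr p)"
  using assms p by (intro continuous_on_powr' continuous_intros) auto

lemma powr_bound: "0 \<le> a \<Longrightarrow> a \<le> M \<Longrightarrow> \<bar>a powr p\<bar> \<le> M powr p"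
  using p by (simp add: powr_mono2)

text \<open>The power has Lipschitz constant \<open>p * M powr (p - 1)\<close> on the ball and the
  potential has norm at most \<open>2 * sqrt (T / pi)\<close>; by \<open>contraction\<close> their
  product is at most 1/2.\<close>

lemma contraction_step:
  assumes f: "continuous_on {0<..<T} f" "\<And>s. s \<in> {0<..<T} \<Longrightarrow> 0 \<le> f s \<and> f s \<le> M"
    and g: "continuous_on {0<..<T} g" "\<And>s. s \<in> {0<..<T} \<Longrightarrow> 0 \<le> g s \<and> g s \<le> M"
    and fg: "\<And>s. s \<in> {0<..<T} \<Longrightarrow> \<bar>f s - g s\<bar> \<le> C" and t: "t \<in> {0<..<T}"
  shows "\<bar>bdry_potential (\<lambda>s. f s powr p) r t - bdry_potential (\<lambda>s. g s powr p) r t\<bar> \<le> C / 2"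
proof -
  have C: "0 \<le> C" using fg[OF t] by linarith
  have "\<bar>f s powr p - g s powr p\<bar> \<le> p * M powr (p - 1) * C" if s: "s \<in> {0<..<T}" for s
  proof -
    have "\<bar>f s powr p - g s powr p\<bar> \<le> p * M powr (p - 1) * \<bar>f s - g s\<bar>"
      using f(2)[OF s] g(2)[OF s] p by (intro abs_powr_diff_le) auto
    also have "\<dots> \<le> p * M powr (p - 1) * C"
      using fg[OF s] p by (intro mult_left_mono) auto
    finally show ?thesis .
  qed
  then have "\<bar>bdry_potential (\<lambda>s. f s powr p) r t - bdry_potential (\<lambda>s. g s powr p) r t\<bar>
      \<le> 2 * sqrt (T / pi) * (p * M powr (p - 1) * C)"
    using f g t by (intro abs_bdry_potential_diff_le[where A = "M powr p"] powr_cont powr_bound) auto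
  also have "\<dots> = (2 * sqrt (T / pi) * (p * M powr (p - 1))) * C" by simp
  also have "\<dots> \<le> 1 / 2 * C" using C by (intro mult_right_mono contraction)
  finally show ?thesis by simp
qed

text \<open>The upper bound is the contraction estimate against the zero density, at distance at
  most \<open>M\<close>. Adding \<open>h \<le> M / 2\<close> shows that the iteration stays between
  0 and \<open>M\<close>.\<close>

lemma powr_bdry_potential_bounds:
  assumes f: "continuous_on {0<..<T} f" "\<And>s. s \<in> {0<..<T} \<Longrightarrow> 0 \<le> f s \<and> f s \<le> M"
    and t: "t \<in> {0<..<T}"
  shows "0 \<le> bdry_potential (\<lambda>s. f s powr p) r t" "bdry_potential (\<lambda>s. f s powr p) r t \<le> M / 2"
proof -
  show "0 \<le> bdry_potential (\<lambda>s. f s powr p) r t"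
    using f t by (intro bdry_potential_nonneg[where T = T and C = "M powr p"] powr_cont powr_bound) auto
  have "\<bar>bdry_potential (\<lambda>s. f s powr p) r t - bdry_potential (\<lambda>s. 0 powr p) r t\<bar> \<le> M / 2"
    using f M t by (intro contraction_step) auto
  then show "bdry_potential (\<lambda>s. f s powr p) r t \<le> M / 2"
    by (simp add: bdry_potential_def)
qed

lemma powr_bdry_potential_cont:
  assumes f: "continuous_on {0<..<T} f" "\<And>s. s \<in> {0<..<T} \<Longrightarrow> 0 \<le> f s \<and> f s \<le> M"
  shows "continuous_on (UNIV \<times> {0<..<T}) (\<lambda>(r, t). bdry_potential (\<lambda>s. f s powr p) r t)"
  using f by (intro continuous_on_bdry_potential[where C = "M powr p"] powr_cont powr_bound) auto

lemma picard_props: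
  "continuous_on {0<..<T} (picard h p n) \<and> (\<forall>t\<in>{0<..<T}. 0 \<le> picard h p n t \<and> picard h p n t \<le> M)"
proof (induction n)
  case 0
  then show ?case using M by (simp add: picard.simps(1)[abs_def])
next
  case (Suc n)
  have "continuous_on {0<..<T} ((\<lambda>(r, t). bdry_potential (\<lambda>s. picard h p n s powr p) r t) \<circ> (\<lambda>t. (0, t)))"
    using Suc by (intro continuous_on_compose continuous_on_subset[OF powr_bdry_potential_cont]
        continuous_intros) auto
  then have "continuous_on {0<..<T} (picard h p (Suc n))"
    by (auto simp: o_def picard.simps(2)[abs_def] intro!: continuous_on_add h_cont)
  moreover have "0 \<le> picard h p (Suc n) t \<and> picard h p (Suc n) t \<le> M" if t: "t \<in> {0<..<T}" for t
    using powr_bdry_potential_bounds[of "picard h p n" t 0] h_bounds[OF t] Suc t by auto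
  ultimately show ?case by blast
qed

text \<open>Iterate 0 vanishes and every iterate lies between 0 and \<open>M\<close>, which starts
  the induction; each further step halves the distance.\<close>

lemma picard_dist:
  assumes "t \<in> {0<..<T}"
  shows "\<bar>picard h p (n + j) t - picard h p n t\<bar> \<le> M / 2 ^ n"
  using assms
proof (induction n arbitrary: t)
  case 0
  then show ?case using picard_props[of j] by auto
next
  case (Suc n)
  have "\<bar>bdry_potential (\<lambda>s. picard h p (n + j) s powr p) 0 t
      - bdry_potential (\<lambda>s. picard h p n s powr p) 0 t\<bar> \<le> (M / 2 ^ n) / 2"
    using Suc picard_props by (intro contraction_step) blast+
  then show ?case by simp
qed

text \<open>The geometric rate is uniform in time, so the limit is continuous and solves the
  fixed-point equation. The convergence itself is also kept, since minimality is proved through the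
  iterates.\<close>

lemma picard_limit:
  obtains v where "continuous_on {0<..<T} v"
    and "\<And>t. t \<in> {0<..<T} \<Longrightarrow> 0 \<le> v t \<and> v t \<le> M"
    and "\<And>t. t \<in> {0<..<T} \<Longrightarrow> v t = h t + bdry_potential (\<lambda>s. v s powr p) 0 t"
    and "\<And>t. t \<in> {0<..<T} \<Longrightarrow> (\<lambda>n. picard h p n t) \<longlonglongrightarrow> v t"
proof -
  define v where "v t = lim (\<lambda>n. picard h p n t)" for t
  have small: "(\<lambda>n. M / 2 ^ n) \<longlonglongrightarrow> 0"
    using LIMSEQ_divide_realpow_zero[of 2 M] by simp
  have lim: "(\<lambda>n. picard h p n t) \<longlonglongrightarrow> v t" if t: "t \<in> {0<..<T}" for t
  proof -
    have "Cauchy (\<lambda>n. picard h p n t)"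
    proof (rule CauchyI')
      fix e :: real assume "0 < e"
      then obtain N where N: "\<And>n. n \<ge> N \<Longrightarrow> \<bar>M / 2 ^ n\<bar> < e"
        using LIMSEQ_D[OF small] by auto
      have "dist (picard h p m t) (picard h p n t) < e" if "N \<le> m" "m < n" for m n
        using picard_dist[OF t, of m "n - m"] N[OF that(1)] that
        by (simp add: dist_real_def abs_minus_commute M less_imp_le)
      then show "\<exists>N. \<forall>m\<ge>N. \<forall>n>m. dist (picard h p m t) (picard h p n t) < e" by blast
    qed
    then show ?thesis
      unfolding v_def using real_Cauchy_convergent convergent_LIMSEQ_iff by blast
  qed
  \<comment> \<open>Let \<open>j\<close> tend to infinity in \<open>picard_dist\<close>.\<close>
  have dist: "\<bar>v t - picard h p n t\<bar> \<le> M / 2 ^ n" if t: "t \<in> {0<..<T}" for t n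
  proof (rule tendsto_upperbound)
    show "(\<lambda>j. \<bar>picard h p (j + n) t - picard h p n t\<bar>) \<longlonglongrightarrow> \<bar>v t - picard h p n t\<bar>"
      by (intro tendsto_intros LIMSEQ_ignore_initial_segment lim t)
    show "\<forall>\<^sub>F j in sequentially. \<bar>picard h p (j + n) t - picard h p n t\<bar> \<le> M / 2 ^ n"
      using picard_dist[OF t, of n] by (simp add: add.commute)
  qed simp
  have bounds: "0 \<le> v t \<and> v t \<le> M" if t: "t \<in> {0<..<T}" for t
    using picard_props t LIMSEQ_le_const[OF lim[OF t]] LIMSEQ_le_const2[OF lim[OF t]] by blast
  have "uniform_limit {0<..<T} (picard h p) v sequentially"
    unfolding uniform_limit_iff
  proof (intro allI impI)
    fix e :: real assume "0 < e"
    with small have "\<forall>\<^sub>F n in sequentially. M / 2 ^ n < e"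
      by (rule order_tendstoD)
    then show "\<forall>\<^sub>F n in sequentially. \<forall>t\<in>{0<..<T}. dist (picard h p n t) (v t) < e"
    proof eventually_elim
      case (elim n)
      show ?case
      proof
        fix t assume "t \<in> {0<..<T}"
        from dist[OF this, of n] elim show "dist (picard h p n t) (v t) < e"
          by (simp add: dist_real_def abs_minus_commute)
      qed
    qed
  qed
  then have cont: "continuous_on {0<..<T} v"
    using picard_props by (intro uniform_limit_theorem[of _ "picard h p"]) auto
  have "v t = h t + bdry_potential (\<lambda>s. v s powr p) 0 t" if t: "t \<in> {0<..<T}" for t
  proof -
    \<comment> \<open>The contraction estimate with distance \<open>M / 2 ^ n\<close> moves the
      limit inside the potential.\<close>
    have "(\<lambda>n. bdry_potential (\<lambda>s. picard h p n s powr p) 0 t) \<longlonglongrightarrow> bdry_potential (\<lambda>s. v s powr p) 0 t"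
    proof (rule LIM_zero_cancel, rule Lim_null_comparison)
      show "\<forall>\<^sub>F n in sequentially. norm (bdry_potential (\<lambda>s. picard h p n s powr p) 0 t
          - bdry_potential (\<lambda>s. v s powr p) 0 t) \<le> (M / 2 ^ n) / 2"
        unfolding real_norm_def using picard_props cont bounds dist t
        by (intro always_eventually allI contraction_step)
          (auto simp: abs_minus_commute[of "picard h p _ _"])
      show "(\<lambda>n. (M / 2 ^ n) / 2) \<longlonglongrightarrow> 0"
        using tendsto_divide[OF small tendsto_const[of 2]] by simp
    qed
    then have "(\<lambda>n. picard h p (Suc n) t) \<longlonglongrightarrow> h t + bdry_potential (\<lambda>s. v s powr p) 0 t"
      by (auto intro: tendsto_intros)
    with LIMSEQ_Suc[OF lim[OF t]] show ?thesis
      by (rule LIMSEQ_unique)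
  qed
  with cont bounds lim show thesis by (blast intro: that)
qed

end

section \<open>Solutions with datum \<open>\<kappa> exp(l x\<^sub>N\<^sup>2)\<close>\<close>

text \<open>The heat evolution of \<open>exp (l * r^2)\<close> on the line; for \<open>l > 0\<close>
  it becomes singular at \<open>t = 1 / (4 * l)\<close>.\<close>

definition free_solution :: "real \<Rightarrow> real \<Rightarrow> real \<Rightarrow> real" where
  "free_solution l r t = exp (l * r\<^sup>2 / (1 - 4 * l * t)) / sqrt (1 - 4 * l * t)"

lemma nn_integral_neumann_green_exp_square:
  fixes x :: "real ^ 'n"
  assumes "0 < t" "4 * l * t < 1" "0 \<le> \<kappa>"
  shows "(\<integral>\<^sup>+y\<in>closure (half_space k). ennreal (neumann_green k x y t * (\<kappa> * exp (l * (y $ k)\<^sup>2)))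
    \<partial>lebesgue) = ennreal (\<kappa> * free_solution l (x $ k) t)"
proof -
  have "(\<integral>\<^sup>+y\<in>closure (half_space k). ennreal (neumann_green k x y t * (\<kappa> * exp (l * (y $ k)\<^sup>2)))
      \<partial>lebesgue) = (\<integral>\<^sup>+r. ennreal (heat_kernel t (x $ k - r) * (\<kappa> * exp (l * r\<^sup>2))) \<partial>lborel)"
    using assms by (intro nn_integral_neumann_green_half_space) auto
  also have "\<dots> = (\<integral>\<^sup>+r. ennreal \<kappa> * ennreal (heat_kernel t (x $ k - r) * exp (l * r\<^sup>2)) \<partial>lborel)"
    using assms by (simp add: ennreal_mult'[symmetric] mult_ac)
  also have "\<dots> = ennreal \<kappa> * (\<integral>\<^sup>+r. ennreal (heat_kernel t (x $ k - r) * exp (l * r\<^sup>2)) \<partial>lborel)"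
    by (rule nn_integral_cmult) measurable
  also have "\<dots> = ennreal (\<kappa> * free_solution l (x $ k) t)"
    using assms
    by (simp only: nn_integral_heat_kernel_exp_square free_solution_def ennreal_mult')
  finally show ?thesis .
qed

lemma nn_integral_neumann_green_bdry_potential:
  fixes x :: "real ^ 'n"
  assumes "continuous_on {0<..<T} g" "\<And>s. s \<in> {0<..<T} \<Longrightarrow> 0 \<le> g s \<and> g s \<le> C"
    and t: "t \<in> {0<..<T}"
  shows "(\<integral>\<^sup>+s\<in>{0<..<t}. (\<integral>\<^sup>+z. ennreal (neumann_green k x (bdry_pt k z) (t - s) * g s)
      \<partial>(\<Pi>\<^sub>M i\<in>- {k}. lborel)) \<partial>lborel) = ennreal (bdry_potential g (x $ k) t)"
proof -
  have "(\<integral>\<^sup>+s\<in>{0<..<t}. (\<integral>\<^sup>+z. ennreal (neumann_green k x (bdry_pt k z) (t - s) * g s)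
      \<partial>(\<Pi>\<^sub>M i\<in>- {k}. lborel)) \<partial>lborel)
    = (\<integral>\<^sup>+s\<in>{0<..<t}. ennreal (2 * heat_kernel (t - s) (x $ k) * g s) \<partial>lborel)"
    using assms by (intro nn_integral_cong) (auto simp: indicator_def nn_integral_neumann_green_bdry)
  also have "\<dots> = ennreal (bdry_potential g (x $ k) t)"
    using assms by (intro ennreal_bdry_potential[where T = T and C = C, symmetric]) auto
  finally show ?thesis .
qed

text \<open>A time-dependent lower bound on the boundary propagates through the integral equation,
  because the Green function is nonnegative and the power is monotone. It drives the induction over
  the Picard iterates and then the comparison with their limit.\<close>

lemma solution_ge:
  fixes w :: "real ^ 'n \<Rightarrow> real \<Rightarrow> real"
  assumes sol: "is_solution k p (\<lambda>x. \<kappa> * exp (l * (x $ k)\<^sup>2)) T w"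
    and p: "1 < p" and \<kappa>: "0 \<le> \<kappa>" and l: "0 < l" and T: "4 * l * T < 1"
    and g: "continuous_on {0<..<T} g" "\<And>s. s \<in> {0<..<T} \<Longrightarrow> 0 \<le> g s \<and> g s \<le> M"
    and le: "\<And>z s. s \<in> {0<..<T} \<Longrightarrow> g s \<le> w (bdry_pt k z) s"
    and x: "x \<in> closure (half_space k)" and t: "t \<in> {0<..<T}"
  shows "\<kappa> * free_solution l (x $ k) t + bdry_potential (\<lambda>s. g s powr p) (x $ k) t \<le> w x t"
proof -
  have lt: "4 * l * t < 1"
    using mult_strict_left_mono[of t T "4 * l"] t l less_trans[OF _ T] by simp
  have gp: "continuous_on {0<..<T} (\<lambda>s. g s powr p)"
    using g p by (intro continuous_on_powr' continuous_intros) auto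
  have gM: "0 \<le> g s powr p \<and> g s powr p \<le> M powr p" if "s \<in> {0<..<T}" for s
    using g(2)[OF that] p by (simp add: powr_mono2)
  have "0 \<le> bdry_potential (\<lambda>s. g s powr p) (x $ k) t"
    using t gp gM by (intro bdry_potential_nonneg[where T = T and C = "M powr p"]) auto
  moreover have "0 \<le> \<kappa> * free_solution l (x $ k) t"
    using \<kappa> lt by (simp add: free_solution_def)
  ultimately have "ennreal (\<kappa> * free_solution l (x $ k) t + bdry_potential (\<lambda>s. g s powr p) (x $ k) t)
    = ennreal (\<kappa> * free_solution l (x $ k) t) + ennreal (bdry_potential (\<lambda>s. g s powr p) (x $ k) t)"
    by simp
  also have "\<dots> = (\<integral>\<^sup>+y\<in>closure (half_space k).
        ennreal (neumann_green k x y t * (\<kappa> * exp (l * (y $ k)\<^sup>2))) \<partial>lebesgue)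
      + (\<integral>\<^sup>+s\<in>{0<..<t}. (\<integral>\<^sup>+z. ennreal (neumann_green k x (bdry_pt k z) (t - s) * g s powr p)
        \<partial>(\<Pi>\<^sub>M i\<in>- {k}. lborel)) \<partial>lborel)"
    using t lt \<kappa> nn_integral_neumann_green_bdry_potential[OF gp gM t, of k x]
    by (simp add: nn_integral_neumann_green_exp_square)
  also have "\<dots> \<le> (\<integral>\<^sup>+y\<in>closure (half_space k).
        ennreal (neumann_green k x y t * (\<kappa> * exp (l * (y $ k)\<^sup>2))) \<partial>lebesgue)
      + (\<integral>\<^sup>+s\<in>{0<..<t}. (\<integral>\<^sup>+z. ennreal (neumann_green k x (bdry_pt k z) (t - s)
        * w (bdry_pt k z) s powr p) \<partial>(\<Pi>\<^sub>M i\<in>- {k}. lborel)) \<partial>lborel)"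
  proof (intro add_left_mono nn_integral_mono)
    fix s :: real
    show "(\<integral>\<^sup>+z. ennreal (neumann_green k x (bdry_pt k z) (t - s) * g s powr p)
        \<partial>(\<Pi>\<^sub>M i\<in>- {k}. lborel)) * indicator {0<..<t} s
      \<le> (\<integral>\<^sup>+z. ennreal (neumann_green k x (bdry_pt k z) (t - s) * w (bdry_pt k z) s powr p)
        \<partial>(\<Pi>\<^sub>M i\<in>- {k}. lborel)) * indicator {0<..<t} s"
    proof (cases "s \<in> {0<..<t}")
      case True
      then have s: "s \<in> {0<..<T}" using t by auto
      have "g s powr p \<le> w (bdry_pt k z) s powr p" for z
        using g(2)[OF s] le[OF s] p by (intro powr_mono2) auto
      then show ?thesis
        using True
        by (auto intro!: nn_integral_mono ennreal_leI mult_left_mono neumann_green_nonneg)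
    qed simp
  qed
  also have "\<dots> = ennreal (w x t)"
    using sol x t by (simp add: is_solution_def)
  finally have "ennreal (\<kappa> * free_solution l (x $ k) t
    + bdry_potential (\<lambda>s. g s powr p) (x $ k) t) \<le> ennreal (w x t)" .
  moreover have "0 \<le> w x t" using sol x t by (simp add: is_solution_def)
  ultimately show ?thesis by (simp only: ennreal_le_iff)
qed

lemma continuous_on_free_solution:
  assumes "0 < l" "4 * l * T < 1"
  shows "continuous_on (UNIV \<times> {0<..<T}) (\<lambda>(r, t). free_solution l r t)"
proof -
  have "4 * l * t < 1" if "t < T" for t
    using mult_strict_left_mono[of t T "4 * l"] that assms(1) less_trans[OF _ assms(2)] by simp
  then show ?thesis
    unfolding free_solution_def case_prod_unfold
    by (intro continuous_intros) (auto simp: mem_Times_iff; force)+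
qed

text \<open>Solve the scalar equation for the boundary trace and extend it by the representation
  formula. The bound on \<open>\<kappa>\<close> keeps the free trace
  \<open>\<kappa> / sqrt (1 - 4 * l * t)\<close> below \<open>M / 2\<close> on the whole time
  interval.\<close>

lemma minimal_solution_exists:
  fixes k :: "'n::finite"
  assumes p: "1 < p" and l: "0 < l" and T: "0 < T" "4 * l * T < 1" and M: "0 < M"
    and contraction: "2 * sqrt (T / pi) * (p * M powr (p - 1)) \<le> 1 / 2"
    and \<kappa>: "0 < \<kappa>" "\<kappa> / sqrt (1 - 4 * l * T) \<le> M / 2"
  shows "\<exists>u. is_minimal_solution k p (\<lambda>x. \<kappa> * exp (l * (x $ k)\<^sup>2)) T u"
proof -
  define h where "h t = \<kappa> * free_solution l 0 t" for t
  have lt: "4 * l * t < 4 * l * T" if "t \<in> {0<..<T}" for t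
    using that l by simp
  have h_cont: "continuous_on {0<..<T} h"
  proof -
    have "continuous_on {0<..<T} ((\<lambda>(r, t). free_solution l r t) \<circ> (\<lambda>t. (0, t)))"
      by (intro continuous_on_compose continuous_on_subset[OF continuous_on_free_solution[OF l T(2)]]
          continuous_intros) auto
    then show ?thesis
      unfolding h_def by (auto simp: o_def intro!: continuous_intros)
  qed
  have h_bounds: "0 \<le> h t \<and> h t \<le> M / 2" if t: "t \<in> {0<..<T}" for t
  proof
    have "h t \<le> \<kappa> / sqrt (1 - 4 * l * T)"
      using lt[OF t] T \<kappa>(1) by (simp add: h_def free_solution_def frac_le)
    then show "h t \<le> M / 2" using \<kappa>(2) by (rule order_trans)
    show "0 \<le> h t"
      using \<kappa>(1) lt[OF t] T by (simp add: h_def free_solution_def)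
  qed
  note ctx = p T(1) M h_cont h_bounds contraction
  obtain v where v: "continuous_on {0<..<T} v"
      "\<And>t. t \<in> {0<..<T} \<Longrightarrow> 0 \<le> v t \<and> v t \<le> M"
      "\<And>t. t \<in> {0<..<T} \<Longrightarrow> v t = h t + bdry_potential (\<lambda>s. v s powr p) 0 t"
      "\<And>t. t \<in> {0<..<T} \<Longrightarrow> (\<lambda>n. picard h p n t) \<longlonglongrightarrow> v t"
    using picard_limit[OF ctx] by blast
  \<comment> \<open>At normal coordinate 0 this formula is the fixed-point equation of
    \<open>v\<close>, so the trace of \<open>u\<close> is \<open>v\<close> and \<open>u\<close>
    satisfies the integral equation.\<close>
  define u where "u x t = \<kappa> * free_solution l (x $ k) t + bdry_potential (\<lambda>s. v s powr p) (x $ k) t"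
    for x :: "real ^ 'n" and t
  have u_bdry: "u (bdry_pt k z) t = v t" if "t \<in> {0<..<T}" for z t
    using v(3)[OF that] by (simp add: u_def h_def)
  have pot_nonneg: "0 \<le> bdry_potential (\<lambda>s. v s powr p) r t" if "t \<in> {0<..<T}" for r t
    using powr_bdry_potential_bounds(1)[OF ctx v(1,2) that] .
  have free_nonneg: "0 \<le> \<kappa> * free_solution l r t" if "t \<in> {0<..<T}" for r t
    using \<kappa> lt[OF that] T by (simp add: free_solution_def)
  have u_cont: "continuous_on (closure (half_space k) \<times> {0<..<T}) (\<lambda>(x, t). u x t)"
  proof -
    have emb: "continuous_on (closure (half_space k) \<times> {0<..<T}) (\<lambda>y. (fst y $ k, snd y))"
      by (intro continuous_intros)
    have "continuous_on (closure (half_space k) \<times> {0<..<T})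
        ((\<lambda>(r, t). free_solution l r t) \<circ> (\<lambda>y. (fst y $ k, snd y)))"
      by (intro continuous_on_compose emb
          continuous_on_subset[OF continuous_on_free_solution[OF l T(2)]]) auto
    moreover have "continuous_on (closure (half_space k) \<times> {0<..<T})
        ((\<lambda>(r, t). bdry_potential (\<lambda>s. v s powr p) r t) \<circ> (\<lambda>y. (fst y $ k, snd y)))"
      by (intro continuous_on_compose emb
          continuous_on_subset[OF powr_bdry_potential_cont[OF ctx v(1,2)]]) auto
    ultimately show ?thesis
      by (auto simp: u_def case_prod_unfold o_def intro!: continuous_intros)
  qed
  have u_eq: "ennreal (u x t) =
      (\<integral>\<^sup>+y\<in>closure (half_space k). ennreal (neumann_green k x y t * (\<kappa> * exp (l * (y $ k)\<^sup>2)))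
        \<partial>lebesgue)
      + (\<integral>\<^sup>+s\<in>{0<..<t}. (\<integral>\<^sup>+z. ennreal (neumann_green k x (bdry_pt k z) (t - s)
        * u (bdry_pt k z) s powr p) \<partial>(\<Pi>\<^sub>M i\<in>- {k}. lborel)) \<partial>lborel)"
    if t: "t \<in> {0<..<T}" for x t
  proof -
    have vp: "0 \<le> v s powr p \<and> v s powr p \<le> M powr p" if "s \<in> {0<..<T}" for s
      using v(2)[OF that] p by (simp add: powr_mono2)
    have "continuous_on {0<..<T} (\<lambda>s. v s powr p)"
      using v p by (intro continuous_on_powr' continuous_intros) auto
    note pot = nn_integral_neumann_green_bdry_potential[OF this vp t, of k x]
    have "(\<integral>\<^sup>+s\<in>{0<..<t}. (\<integral>\<^sup>+z. ennreal (neumann_green k x (bdry_pt k z) (t - s)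
        * u (bdry_pt k z) s powr p) \<partial>(\<Pi>\<^sub>M i\<in>- {k}. lborel)) \<partial>lborel)
      = (\<integral>\<^sup>+s\<in>{0<..<t}. (\<integral>\<^sup>+z. ennreal (neumann_green k x (bdry_pt k z) (t - s) * v s powr p)
        \<partial>(\<Pi>\<^sub>M i\<in>- {k}. lborel)) \<partial>lborel)"
      using t by (intro nn_integral_cong) (auto simp: indicator_def u_bdry)
    then show ?thesis
      using pot t lt[OF t] T \<kappa> pot_nonneg[OF t] free_nonneg[OF t]
      by (simp add: nn_integral_neumann_green_exp_square u_def)
  qed
  have "(\<lambda>x. \<kappa> * exp (l * (x $ k)\<^sup>2)) \<in> borel_measurable (lebesgue_on (half_space k))"
    by (intro continuous_imp_measurable_on_sets_lebesgue continuous_intros)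
      (simp add: half_space_def)
  then have "is_solution k p (\<lambda>x. \<kappa> * exp (l * (x $ k)\<^sup>2)) T u"
    using T \<kappa> u_cont u_eq pot_nonneg free_nonneg
    by (simp add: is_solution_def u_def)
  moreover have "u x t \<le> w x t"
    if sol: "is_solution k p (\<lambda>x. \<kappa> * exp (l * (x $ k)\<^sup>2)) T w"
      and x: "x \<in> closure (half_space k)" and t: "t \<in> {0<..<T}" for w x t
  proof -
    note ge = solution_ge[OF sol p less_imp_le[OF \<kappa>(1)] l T(2)]
    \<comment> \<open>The zero iterate lies below \<open>w\<close> since solutions are nonnegative;
      \<open>solution_ge\<close> at boundary points gives the step. In the limit \<open>v\<close>
      lies below the trace of \<open>w\<close>, and one more use of \<open>solution_ge\<close>
      carries this into the half space.\<close>
    have "picard h p n s \<le> w (bdry_pt k z) s" if "s \<in> {0<..<T}" for n z s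
      using that
    proof (induction n arbitrary: z s)
      case 0
      then show ?case
        using sol by (simp add: is_solution_def bdry_pt_in_closure)
    next
      case (Suc n)
      then show ?case
        using ge[of "picard h p n" M "bdry_pt k z" s] picard_props[OF ctx, of n]
        by (simp add: h_def[symmetric] bdry_pt_in_closure)
    qed
    then have "v s \<le> w (bdry_pt k z) s" if "s \<in> {0<..<T}" for z s
      using LIMSEQ_le_const2[OF v(4)[OF that]] that by blast
    then show ?thesis
      unfolding u_def using ge[OF v(1,2) _ x t] by blast
  qed
  ultimately show ?thesis
    by (auto simp: is_minimal_solution_def)
qed

text \<open>If \<open>T\<close> exceeded \<open>1 / (4 * l)\<close>, the equation at the origin at
  that time would equate a real number with an infinite datum term.\<close>

lemma no_solution_beyond:
  fixes k :: "'n::finite"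
  assumes sol: "is_solution k p (\<lambda>x. \<kappa> * exp (l * (x $ k)\<^sup>2)) T u" and l: "0 < l" and \<kappa>: "0 < \<kappa>"
  shows "T \<le> 1 / (4 * l)"
proof (rule ccontr)
  assume T: "\<not> T \<le> 1 / (4 * l)"
  define t where "t = 1 / (4 * l)"
  have t: "0 < t" "t < T" using T l by (auto simp: t_def)
  have "(\<integral>\<^sup>+y\<in>closure (half_space k). ennreal (neumann_green k 0 y t * (\<kappa> * exp (l * (y $ k)\<^sup>2)))
      \<partial>lebesgue) = (\<integral>\<^sup>+r. ennreal (heat_kernel t ((0 :: real ^ 'n) $ k - r) * (\<kappa> * exp (l * r\<^sup>2))) \<partial>lborel)"
    using t \<kappa> by (intro nn_integral_neumann_green_half_space) auto
  also have "\<dots> = (\<integral>\<^sup>+r. ennreal \<kappa> * ennreal (heat_kernel t (- r) * exp (l * r\<^sup>2)) \<partial>lborel)"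
    using \<kappa> by (simp add: ennreal_mult'[symmetric] mult_ac)
  also have "\<dots> = ennreal \<kappa> * (\<integral>\<^sup>+r. ennreal (heat_kernel t (- r) * exp (l * r\<^sup>2)) \<partial>lborel)"
    by (rule nn_integral_cmult) measurable
  also have "\<dots> = \<infinity>"
    unfolding t_def nn_integral_heat_kernel_exp_square_critical[OF l]
    using \<kappa> by (simp add: ennreal_mult_top)
  finally have "ennreal (u 0 t) = \<infinity>"
    using sol t by (simp add: is_solution_def closure_half_space)
  then show False by simp
qed

theorem theorem1p3:
  fixes k :: "'n::finite" and p l :: real
    and \<psi> :: "real ^ 'n \<Rightarrow> real"
  assumes "p > 1" and "l > 0"
    and "\<And>x. \<psi> x = exp (l * (x $ k)\<^sup>2)"
  shows "((\<lambda>\<kappa>::real. life_span k p (\<lambda>x. \<kappa> * \<psi> x)) \<longlongrightarrow> ennreal (inverse (4 * l))) (at_right 0)"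
proof (rule order_tendstoI)
  note p = assms(1) and l = assms(2)
  have \<psi>: "\<psi> = (\<lambda>x. exp (l * (x $ k)\<^sup>2))" using assms(3) by auto
  \<comment> \<open>The upper half holds for every \<open>\<kappa> > 0\<close>, not merely for small
    ones.\<close>
  show "\<forall>\<^sub>F \<kappa> in at_right 0. life_span k p (\<lambda>x. \<kappa> * \<psi> x) < a" if a: "ennreal (inverse (4 * l)) < a" for a
    using eventually_at_right_less[of 0]
  proof eventually_elim
    case (elim \<kappa>)
    have "life_span k p (\<lambda>x. \<kappa> * \<psi> x) \<le> ennreal (inverse (4 * l))"
      unfolding life_span_def \<psi>
      using no_solution_beyond[OF _ l elim]
      by (intro Sup_least)
        (auto simp: is_minimal_solution_def inverse_eq_divide intro!: ennreal_leI)
    then show ?case using a by (rule le_less_trans)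
  qed
  show "\<forall>\<^sub>F \<kappa> in at_right 0. a < life_span k p (\<lambda>x. \<kappa> * \<psi> x)" if a: "a < ennreal (inverse (4 * l))" for a
  proof -
    \<comment> \<open>An intermediate \<open>b\<close> leaves a strictly subcritical time
      \<open>T\<close>, on which a minimal solution is to be found.\<close>
    obtain b where b: "a < b" "b < ennreal (inverse (4 * l))" using dense[OF a] by blast
    define T where "T = enn2real b"
    have bT: "b = ennreal T"
      using b by (simp add: T_def ennreal_enn2real_if less_top[symmetric] top_unique) auto
    have "b > 0" using b(1) by (rule le_less_trans[rotated]) simp
    then have T: "0 < T" by (simp add: bT)
    have "T < inverse (4 * l)" using b(2) T l by (simp add: bT ennreal_less_iff)
    then have lT: "4 * l * T < 1" using l by (simp add: field_simps)
    \<comment> \<open>\<open>q\<close> gives equality in the contraction condition, and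
      \<open>M\<close> is chosen so that \<open>M powr (p - 1) = q\<close>; neither depends on
      \<open>\<kappa>\<close>, which can therefore be taken small afterwards.\<close>
    define q where "q = 1 / (4 * p * sqrt (T / pi))"
    define M where "M = q powr (1 / (p - 1))"
    have q: "0 < q" using p T by (simp add: q_def)
    then have M: "0 < M" by (simp add: M_def)
    have "M powr (p - 1) = q" using p q by (simp add: M_def powr_powr)
    then have contraction: "2 * sqrt (T / pi) * (p * M powr (p - 1)) \<le> 1 / 2"
      using p T by (simp add: q_def)
    have "0 < M / 2 * sqrt (1 - 4 * l * T)" using M lT by simp
    then have "\<forall>\<^sub>F \<kappa> in at_right 0. 0 < \<kappa> \<and> \<kappa> < M / 2 * sqrt (1 - 4 * l * T)"
      by (intro eventually_conj eventually_at_right_less eventually_at_rightI[where b = "M / 2 * sqrt (1 - 4 * l * T)"]) auto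
    then show ?thesis
    proof eventually_elim
      case (elim \<kappa>)
      then have "\<kappa> / sqrt (1 - 4 * l * T) \<le> M / 2"
        using lT by (simp add: field_simps)
      then have "\<exists>u. is_minimal_solution k p (\<lambda>x. \<kappa> * \<psi> x) T u"
        unfolding \<psi> using minimal_solution_exists[OF p l T lT M contraction] elim by blast
      then have "b \<le> life_span k p (\<lambda>x. \<kappa> * \<psi> x)"
        unfolding life_span_def bT using T by (intro Sup_upper) auto
      with b(1) show ?case by (rule less_le_trans)
    qed
  qed
qed

end
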